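(* $gr^3_2(B_5)=9$.
   Context: $K_n$ is the complete graph of order $n$. The book $B_n:=K_2+nK_1$ (graph join) is the graph on $n+2$ vertices consisting of an edge $xy$ (the spine) together with $n$ further, pairwise non-adjacent vertices (the pages), each adjacent to both $x$ and $y$. A $t$-coloring of $K_p$ is a map $f:E(K_p)\to\{1,\dots,t\}$, not assumed surjective. A Gallai $t$-coloring is a $t$-coloring with no rainbow triangle, i.e. there are no three vertices $x,y,z$ such that $f(xy),f(xz),f(yz)$ are pairwise distinct. For $1\le s<t$ and a graph $G$, the weakened Gallai-Ramsey number $gr^t_s(G)$ is the least $p\in\mathbb{N}$ such that every Gallai $t$-coloring of $K_p$ contains a (not necessarily induced) subgraph isomorphic to $G$ whose edges use at most $s$ colors. *)

theory Defs
  imports Main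
begin

text \<open>Finite simple graphs as pairs of a vertex set and a set of two-element vertex sets.\<close>

type_synonym 'a graph = "'a set \<times> 'a set set"

abbreviation verts :: "'a graph \<Rightarrow> 'a set" where
  "verts \<equiv> fst"

abbreviation edges :: "'a graph \<Rightarrow> 'a set set" where
  "edges \<equiv> snd"

definition simple_graph :: "'a graph \<Rightarrow> bool" where
  "simple_graph G \<longleftrightarrow> finite (verts G) \<and> (\<forall>e\<in>edges G. e \<subseteq> verts G \<and> card e = 2)"

definition complete_graph :: "nat \<Rightarrow> nat graph" where
  "complete_graph n = ({..<n}, {e. e \<subseteq> {..<n} \<and> card e = 2})"

definition edgeless_graph :: "nat \<Rightarrow> nat graph" where
  "edgeless_graph n = ({..<n}, {})"

definition graph_join :: "'a graph \<Rightarrow> 'b graph \<Rightarrow> ('a + 'b) graph" where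
  "graph_join G H =
     (verts G <+> verts H,
      (\<lambda>e. Inl ` e) ` edges G \<union> (\<lambda>e. Inr ` e) ` edges H
        \<union> {{Inl u, Inr v} | u v. u \<in> verts G \<and> v \<in> verts H})"

definition book :: "nat \<Rightarrow> (nat + nat) graph" where
  "book n = graph_join (complete_graph 2) (edgeless_graph n)"

text \<open>Subgraphs need not be induced.\<close>

definition subgraph :: "'a graph \<Rightarrow> 'a graph \<Rightarrow> bool" where
  "subgraph H G \<longleftrightarrow> simple_graph H \<and> verts H \<subseteq> verts G \<and> edges H \<subseteq> edges G"

definition graph_iso :: "'a graph \<Rightarrow> 'b graph \<Rightarrow> bool" where
  "graph_iso G H \<longleftrightarrow>
     (\<exists>\<phi>. bij_betw \<phi> (verts G) (verts H) \<and>
       (\<forall>u\<in>verts G. \<forall>v\<in>verts G. {u, v} \<in> edges G \<longleftrightarrow> {\<phi> u, \<phi> v} \<in> edges H))"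

text \<open>Only the values of a coloring on the edges of the graph matter, and not every color has
  to occur.\<close>

definition edge_coloring :: "nat \<Rightarrow> 'a graph \<Rightarrow> ('a set \<Rightarrow> nat) \<Rightarrow> bool" where
  "edge_coloring t G f \<longleftrightarrow> (\<forall>e\<in>edges G. f e \<in> {1..t})"

definition rainbow_triangle :: "nat \<Rightarrow> (nat set \<Rightarrow> nat) \<Rightarrow> nat \<Rightarrow> nat \<Rightarrow> nat \<Rightarrow> bool" where
  "rainbow_triangle p f x y z \<longleftrightarrow>
     {x, y, z} \<subseteq> verts (complete_graph p) \<and> x \<noteq> y \<and> x \<noteq> z \<and> y \<noteq> z \<and>
     f {x, y} \<noteq> f {x, z} \<and> f {x, y} \<noteq> f {y, z} \<and> f {x, z} \<noteq> f {y, z}"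

definition gallai_coloring :: "nat \<Rightarrow> nat \<Rightarrow> (nat set \<Rightarrow> nat) \<Rightarrow> bool" where
  "gallai_coloring t p f \<longleftrightarrow>
     edge_coloring t (complete_graph p) f \<and> \<not> (\<exists>x y z. rainbow_triangle p f x y z)"

definition contains_with_colors ::
    "nat \<Rightarrow> 'a graph \<Rightarrow> nat \<Rightarrow> (nat set \<Rightarrow> nat) \<Rightarrow> bool" where
  "contains_with_colors s G p f \<longleftrightarrow>
     (\<exists>H. subgraph H (complete_graph p) \<and> graph_iso G H \<and> card (f ` edges H) \<le> s)"

text \<open>Meaningful for \<open>1 \<le> s < t\<close>. If no suitable \<open>p\<close> existed, the value would be
  unspecified.\<close>

definition weak_gallai_ramsey :: "nat \<Rightarrow> nat \<Rightarrow> 'a graph \<Rightarrow> nat" where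
  "weak_gallai_ramsey t s G =
     (LEAST p. \<forall>f. gallai_coloring t p f \<longrightarrow> contains_with_colors s G p f)"

end

theory Submission
  imports Defs
begin

text \<open>In a Gallai coloring every three colors include a disconnected one, say \<open>k\<close>, and the edges
  between two \<open>k\<close>-components all have the same color. Suppose that \<open>K\<^sub>9\<close> contains no two-colored
  \<open>B\<^sub>5\<close>: if \<open>xy\<close> does not have color \<open>k\<close>, then at least three further vertices are joined to \<open>x\<close> or
  \<open>y\<close> in color \<open>k\<close>. Two \<open>k\<close>-components thus have at least five vertices in total, so there are at
  most three of them, and the vertices split into two parts joined in a single color \<open>m\<close>. If the
  smaller part contains two vertices, a color other than \<open>m\<close> and the color of their edge contradicts
  the assumption. Otherwise it is a single vertex, the edges of color \<open>m\<close> among the other eight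
  vertices form a matching, and a parity argument finishes the proof.

  For the lower bound, replace each vertex of the self-complementary 2-coloring of \<open>K\<^sub>4\<close> by an edge
  of the third color.\<close>

section \<open>Disconnected colors in Gallai colorings\<close>

text \<open>A coloring is a symmetric function of two vertices here, over an arbitrary vertex set,
  so that an induction can pass to smaller sets.\<close>

locale gallai =
  fixes V :: "'a set" and c :: "'a \<Rightarrow> 'a \<Rightarrow> 'c"
  assumes sym: "c x y = c y x"
    and no_rainbow: "\<lbrakk>x \<in> V; y \<in> V; z \<in> V; x \<noteq> y; x \<noteq> z; y \<noteq> z\<rbrakk>
      \<Longrightarrow> c x y = c x z \<or> c x y = c y z \<or> c x z = c y z"
begin

definition color_edges :: "'c \<Rightarrow> ('a \<times> 'a) set" where
  "color_edges k = {(x, y). x \<in> V \<and> y \<in> V \<and> x \<noteq> y \<and> c x y = k}"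

definition linked :: "'c \<Rightarrow> 'a \<Rightarrow> 'a \<Rightarrow> bool" where
  "linked k x y \<longleftrightarrow> (x, y) \<in> (color_edges k)\<^sup>*"

lemma linked_refl [simp]: "linked k x x"
  by (simp add: linked_def)

lemma linked_sym: "linked k x y \<Longrightarrow> linked k y x"
proof -
  have "Relation.sym (color_edges k)"
    by (auto simp: color_edges_def intro!: symI sym)
  then show "linked k x y \<Longrightarrow> linked k y x"
    unfolding linked_def by (meson sym_rtrancl symD)
qed

lemma linked_trans: "linked k x y \<Longrightarrow> linked k y z \<Longrightarrow> linked k x z"
  by (simp add: linked_def)

lemma linked_edge: "\<lbrakk>x \<in> V; y \<in> V; x \<noteq> y; c x y = k\<rbrakk> \<Longrightarrow> linked k x y"
  by (auto simp: linked_def color_edges_def)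

lemma linked_in_V: "linked k x y \<Longrightarrow> x \<in> V \<Longrightarrow> y \<in> V"
  unfolding linked_def by (induction rule: rtrancl_induct) (auto simp: color_edges_def)

text \<open>Along an edge \<open>u w\<close> of color \<open>k\<close>, both \<open>u y\<close> and
  \<open>w y\<close> avoid \<open>k\<close>, so the triangle \<open>u w y\<close> forces them to
  agree; induct along the path from \<open>x\<close> to \<open>x'\<close>.\<close>

lemma color_const_left:
  assumes "linked k x x'" "x \<in> V" "y \<in> V" "\<not> linked k x y"
  shows "c x' y = c x y"
  using assms(1) unfolding linked_def
proof (induction rule: rtrancl_induct)
  case (step u w)
  have u: "linked k x u" and w: "linked k x w"
    using step.hyps by (auto simp: linked_def)
  have uw: "u \<in> V" "w \<in> V" "u \<noteq> w" "c u w = k"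
    using step.hyps by (auto simp: color_edges_def)
  have "u \<noteq> y" "w \<noteq> y"
    using u w assms(4) by auto
  moreover have "c u y \<noteq> k" "c w y \<noteq> k"
    using u w assms(3,4) uw \<open>u \<noteq> y\<close> \<open>w \<noteq> y\<close> linked_edge linked_trans by metis+
  ultimately show ?case
    using no_rainbow[of u w y] uw assms(3) step.IH by auto
qed simp

lemma color_const:
  assumes "linked k x x'" "linked k y y'" "x \<in> V" "y \<in> V" "\<not> linked k x y"
  shows "c x' y' = c x y"
proof -
  have "c x' y = c x y"
    using assms color_const_left by blast
  moreover have "c y' x' = c y x'"
    using assms color_const_left[of k y y' x'] linked_in_V linked_sym linked_trans by meson
  ultimately show ?thesis
    using sym by metis
qed

lemma linked_cut:
  assumes "linked k x y" "x \<in> S" and "\<And>u w. \<lbrakk>u \<in> S; w \<in> V - S\<rbrakk> \<Longrightarrow> c u w \<noteq> k"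
  shows "y \<in> S"
  using assms(1) unfolding linked_def
  by (induction rule: rtrancl_induct) (use assms(2,3) in \<open>auto simp: color_edges_def\<close>)

end

lemma gallai_subset: "gallai V c \<Longrightarrow> W \<subseteq> V \<Longrightarrow> gallai W c"
  unfolding gallai_def by blast

text \<open>Induction on the vertex set. If adding \<open>v\<close> made every color of
  \<open>K\<close> connected, \<open>v\<close> would join up the components of a color
  \<open>k\<close> disconnected on \<open>W\<close>. Two further colors at \<open>v\<close> are then
  both forced on edges between the same two \<open>k\<close>-components, which carry a single
  color.\<close>

lemma gallai_disconnected_color:
  assumes "finite V" "gallai V c" "card V \<ge> 2" "card K \<ge> 3"
  shows "\<exists>k\<in>K. \<exists>x\<in>V. \<exists>y\<in>V. \<not> gallai.linked V c k x y"
  using assms(1-3)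
proof (induction rule: finite_induct)
  case (insert v W)
  interpret G: gallai "insert v W" c by fact
  interpret H: gallai W c using insert.prems gallai_subset by blast
  show ?case
  proof (rule ccontr)
    assume "\<not> ?thesis"
    then have conn: "G.linked k x y" if "k \<in> K" "x \<in> insert v W" "y \<in> insert v W" for k x y
      using that by blast
    have crossing: "\<exists>u\<in>S. \<exists>w\<in>insert v W - S. c u w = k"
      if "k \<in> K" "x \<in> S" "y \<in> insert v W - S" "S \<subseteq> insert v W" for k S x y
      using G.linked_cut[of k x y S] conn[of k x y] that by blast
    have "W \<noteq> {}"
      using insert.prems insert.hyps by auto
    then obtain w0 where w0: "w0 \<in> W" by blast
    have v_edge: "\<exists>u\<in>W. c v u = k" if "k \<in> K" for k
      using crossing[of k v "{v}" w0] that w0 insert.hyps by auto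
    show False
    proof (cases "card W \<ge> 2")
      case True
      then obtain k x y where k: "k \<in> K" "x \<in> W" "y \<in> W" "\<not> H.linked k x y"
        using insert.IH H.gallai_axioms by blast
      have "card (K - {k}) \<ge> 2"
        using assms(4) k(1) by (auto simp: card_Diff_singleton_if)
      then obtain i j where ij: "i \<in> K" "j \<in> K" "i \<noteq> k" "j \<noteq> k" "i \<noteq> j"
        by (auto simp: numeral_2_eq_2 card_le_Suc_iff)
      \<comment> \<open>An edge of color \<open>k\<close> must leave the \<open>k\<close>-component
        of \<open>z\<close> in \<open>W\<close>; it cannot end in \<open>W\<close>, so it ends in
        \<open>v\<close>.\<close>
      have link_v: "\<exists>z'. H.linked k z z' \<and> c v z' = k" if z: "z \<in> W" for z
      proof -
        let ?S = "{z'. H.linked k z z'}"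
        have SW: "?S \<subseteq> W"
          using H.linked_in_V z by blast
        obtain u w where uw: "u \<in> ?S" "w \<in> insert v W - ?S" "c u w = k"
          using crossing[of k z ?S v] SW k(1) insert.hyps by auto
        have "w = v"
          using uw SW H.linked_edge[of u w k] H.linked_trans[of k z u w] by auto
        then show ?thesis
          using uw G.sym by auto
      qed
      \<comment> \<open>In the triangle \<open>v u z'\<close> the edge \<open>v z'\<close> has color
        \<open>k\<close>, while \<open>u z'\<close> runs between components and avoids
        \<open>k\<close>; hence it has the color \<open>l\<close> of \<open>v u\<close>.\<close>
      have spread: "c u z = l"
        if l: "u \<in> W" "c v u = l" "l \<noteq> k" "z \<in> W" "\<not> H.linked k u z" for u l z
      proof -
        obtain z' where z': "H.linked k z z'" "c v z' = k"
          using link_v l by blast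
        have nl: "\<not> H.linked k u z'"
          using z' l(5) H.linked_sym H.linked_trans by blast
        have "z' \<in> W"
          using z' l(4) H.linked_in_V by blast
        have "u \<noteq> z'" "v \<noteq> u" "v \<noteq> z'"
          using nl l(1) \<open>z' \<in> W\<close> insert.hyps by auto
        have "c u z' \<noteq> k"
          using \<open>u \<noteq> z'\<close> nl H.linked_edge l(1) \<open>z' \<in> W\<close> by blast
        then have "c u z' = l"
          using \<open>u \<noteq> z'\<close> \<open>v \<noteq> u\<close> \<open>v \<noteq> z'\<close> G.no_rainbow[of v u z'] l z' \<open>z' \<in> W\<close>
          by auto
        then show ?thesis
          using H.color_const[of k u u z z'] z' l by simp
      qed
      obtain u w where u: "u \<in> W" "c v u = i" and w: "w \<in> W" "c v w = j"
        using v_edge ij by blast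
      show False
      proof (cases "H.linked k u w")
        case False
        then have "c u w = i" "c w u = j"
          using spread[of u i w] spread[of w j u] u w ij H.linked_sym by auto
        then show False
          using ij H.sym by metis
      next
        case True
        \<comment> \<open>A vertex \<open>z\<close> outside the common component of \<open>u\<close>
          and \<open>w\<close> sees both in the same color, but \<open>spread\<close> gives
          \<open>i\<close> and \<open>j\<close>.\<close>
        obtain z where z: "z \<in> W" "\<not> H.linked k u z"
          using k H.linked_sym H.linked_trans u by metis
        then have "\<not> H.linked k w z"
          using True H.linked_trans by blast
        then have "c u z = i" "c w z = j"
          using spread u w ij z by auto
        then show False
          using H.color_const_left[OF True] u z ij by auto
      qed
    next
      case False
      \<comment> \<open>Now \<open>v w0\<close> is the only edge at \<open>v\<close>, so
        \<open>v_edge\<close> leaves room for one color only.\<close>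
      then have "W = {w0}"
        using w0 insert.hyps by (metis One_nat_def Suc_1 card_1_singletonE card_0_eq
            empty_iff le_Suc_eq nat_le_linear le_zero_eq singletonD)
      then have "K \<subseteq> {c v w0}"
        using v_edge by auto
      then have "card K \<le> 1"
        by (metis card_mono finite.emptyI finite.insertI card.empty card_insert_disjoint
            empty_iff One_nat_def)
      then show False
        using assms(4) by simp
    qed
  qed
qed simp

section \<open>Nine vertices\<close>

text \<open>These are the vertices that cannot be pages over the spine \<open>x y\<close> when color
  \<open>k\<close> is forbidden.\<close>

definition color_nbhd :: "'a set \<Rightarrow> ('a \<Rightarrow> 'a \<Rightarrow> 'c) \<Rightarrow> 'c \<Rightarrow> 'a \<Rightarrow> 'a \<Rightarrow> 'a set" where
  "color_nbhd V c k x y = {w \<in> V - {x, y}. c x w = k \<or> c y w = k}"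

text \<open>The bound in \<open>nbhd\<close> encodes the absence of a two-colored book with five
  pages: of the seven vertices besides \<open>x\<close> and \<open>y\<close>, at most four are pages
  avoiding \<open>k\<close>.\<close>

locale book_free = gallai V c for V :: "'a set" and c :: "'a \<Rightarrow> 'a \<Rightarrow> 'c" +
  fixes K :: "'c set"
  assumes card_V: "card V = 9" and card_K: "card K = 3"
    and colors: "\<lbrakk>x \<in> V; y \<in> V; x \<noteq> y\<rbrakk> \<Longrightarrow> c x y \<in> K"
    and nbhd: "\<lbrakk>x \<in> V; y \<in> V; x \<noteq> y; k \<in> K; c x y \<noteq> k\<rbrakk> \<Longrightarrow> 3 \<le> card (color_nbhd V c k x y)"
begin

lemma finite_V [simp]: "finite V"
  using card_V card.infinite by fastforce

lemma other_color: "\<exists>k\<in>K. k \<noteq> i \<and> k \<noteq> j"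
proof (rule ccontr)
  assume "\<not> ?thesis"
  then have "K \<subseteq> {i, j}" by auto
  then have "card K \<le> card {i, j}" by (intro card_mono) auto
  also have "\<dots> \<le> 2" by (cases "i = j") auto
  finally show False using card_K by simp
qed

text \<open>For a color \<open>k\<close> other than \<open>m\<close> and the color of
  \<open>x y\<close>, the edges of color \<open>k\<close> at \<open>x\<close> and \<open>y\<close>
  stay inside \<open>A\<close>, which has at most two further vertices.\<close>

lemma no_small_part:
  assumes "A \<subseteq> V" "2 \<le> card A" "card A \<le> 4"
    and mono: "\<And>x y. \<lbrakk>x \<in> A; y \<in> V - A\<rbrakk> \<Longrightarrow> c x y = m"
  shows False
proof -
  have fin: "finite A"
    using assms(1) finite_V finite_subset by blast
  obtain x y where xy: "x \<in> A" "y \<in> A" "x \<noteq> y"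
    using assms(2) by (auto simp: numeral_2_eq_2 card_le_Suc_iff)
  obtain k where k: "k \<in> K" "k \<noteq> m" "k \<noteq> c x y"
    using other_color by blast
  have "color_nbhd V c k x y \<subseteq> A - {x, y}"
    using mono xy k(2) unfolding color_nbhd_def by blast
  then have "card (color_nbhd V c k x y) \<le> card (A - {x, y})"
    using fin by (intro card_mono) auto
  also have "\<dots> \<le> 2"
    using xy fin assms(3) by (simp add: card_Diff_subset)
  finally show False
    using nbhd[of x y k] xy k assms(1) by auto
qed

lemma no_dominating_vertex:
  assumes a: "a \<in> V" and mono: "\<And>y. y \<in> V - {a} \<Longrightarrow> c a y = m"
  shows False
proof -
  define B where "B = V - {a}"
  \<comment> \<open>Neighbors of \<open>y\<close> in color \<open>k\<close>, with \<open>a\<close>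
    left out.\<close>
  define M where "M k y = {w \<in> B - {y}. c y w = k}" for k y
  have finB: "finite B" and cardB: "card B = 8"
    using a card_V by (auto simp: B_def)
  have finM: "finite (M k y)" for k y
    using finB by (auto simp: M_def)
  have mK: "m \<in> K"
  proof -
    obtain b where "b \<in> B"
      using cardB by fastforce
    then show ?thesis
      using colors[of a b] mono[of b] a by (auto simp: B_def)
  qed
  have "card (K - {m}) = Suc (Suc 0)"
    using mK card_K by (simp add: card_Diff_singleton_if)
  then obtain i j where ij: "i \<noteq> j" "K - {m} = {i, j}"
    by (auto simp: card_Suc_eq)
  then have K: "K = {m, i, j}" "m \<noteq> i" "m \<noteq> j"
    using mK by auto
  \<comment> \<open>The spine \<open>a y\<close> has color \<open>m\<close>, and \<open>a\<close>
    has no edge of color \<open>k\<close>, so the three vertices from \<open>nbhd\<close> are all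
    neighbors of \<open>y\<close>.\<close>
  have big: "3 \<le> card (M k y)" if "y \<in> B" "k \<in> K" "k \<noteq> m" for k y
  proof -
    have "color_nbhd V c k a y \<subseteq> M k y"
      using that mono by (auto simp: color_nbhd_def M_def B_def)
    then have "card (color_nbhd V c k a y) \<le> card (M k y)"
      using finM by (intro card_mono)
    then show ?thesis
      using nbhd[of a y k] that mono[of y] a by (auto simp: B_def)
  qed
  have total: "card (M m y) + card (M i y) + card (M j y) = 7" if y: "y \<in> B" for y
  proof -
    have "B - {y} = M m y \<union> M i y \<union> M j y"
      using colors[of y] y K(1) by (fastforce simp: M_def B_def)
    moreover have "(M m y \<union> M i y) \<inter> M j y = {}" "M m y \<inter> M i y = {}"
      using K ij by (auto simp: M_def)
    moreover have "card (B - {y}) = 7"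
      using y cardB by simp
    ultimately show ?thesis
      using finM by (metis card_Un_disjoint finite_UnI)
  qed
  \<comment> \<open>Two colors take at least three of the seven neighbors each, so color
    \<open>m\<close> is a matching on \<open>B\<close>.\<close>
  have M_le: "card (M m y) \<le> 1" if y: "y \<in> B" for y
    using total[OF y] big[OF y, of i] big[OF y, of j] K by simp
  have matching: "w = w'" if "y \<in> B" "w \<in> M m y" "w' \<in> M m y" for y w w'
    using M_le[OF that(1)] that(2,3) finM card_le_Suc0_iff_eq by (metis One_nat_def)
  have M_sym: "y \<in> M k w" if "y \<in> B" "w \<in> M k y" for k y w
    using that sym by (auto simp: M_def)
  \<comment> \<open>Only \<open>a\<close> is joined to \<open>u\<close> or \<open>v\<close> in color
    \<open>m\<close>, while \<open>nbhd\<close> demands three vertices.\<close>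
  have unmatched_unique: False
    if "u \<in> B" "v \<in> B" "u \<noteq> v" "M m u = {}" "M m v = {}" for u v
  proof -
    have "c u v \<noteq> m"
      using that by (auto simp: M_def)
    moreover have "color_nbhd V c m u v \<subseteq> {a}"
      using that by (auto simp: color_nbhd_def M_def B_def)
    then have "card (color_nbhd V c m u v) \<le> 1"
      by (metis card.empty card_mono card_insert_disjoint empty_iff finite.emptyI finite.insertI
          One_nat_def)
    ultimately show False
      using nbhd[of u v m] that mK by (auto simp: B_def)
  qed
  obtain b b' where "b \<in> B" "b' \<in> B" "b \<noteq> b'"
    using cardB card_le_Suc0_iff_eq[OF finB] by auto
  then obtain x where x: "x \<in> B" "M m x \<noteq> {}"
    using unmatched_unique by blast
  have "card (M m x) \<noteq> 0"
    using x finM by simp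
  then have three: "card (M i x) = 3" "card (M j x) = 3"
    using total[OF x(1)] big[OF x(1), of i] big[OF x(1), of j] K by simp_all
  \<comment> \<open>If all vertices of \<open>M k x\<close> were matched, \<open>no_rainbow\<close>
    would keep their partners in \<open>M k x\<close>, and the matching would pair up three
    vertices. Applied to both colors \<open>i\<close> and \<open>j\<close>, this yields two distinct
    unmatched vertices.\<close>
  have odd: "\<exists>u\<in>M k x. M m u = {}" if k: "k \<noteq> m" "card (M k x) = 3" for k
  proof (rule ccontr)
    assume "\<not> ?thesis"
    then have "\<forall>u\<in>M k x. \<exists>v. v \<in> M m u" by blast
    then obtain p where p: "\<And>u. u \<in> M k x \<Longrightarrow> p u \<in> M m u"
      by metis
    have p_in: "p u \<in> M k x" if u: "u \<in> M k x" for u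
    proof -
      have uB: "u \<in> B" "u \<noteq> x" "c x u = k"
        using u by (auto simp: M_def)
      have pB: "p u \<in> B" "p u \<noteq> u" "c u (p u) = m"
        using p[OF u] by (auto simp: M_def)
      have "p u \<noteq> x"
        using pB uB k(1) sym by metis
      moreover have "c x (p u) \<noteq> m"
      proof
        assume "c x (p u) = m"
        then have "p u \<in> M m x"
          using pB \<open>p u \<noteq> x\<close> by (auto simp: M_def)
        then have "x \<in> M m (p u)"
          using M_sym x by blast
        moreover have "u \<in> M m (p u)"
          using M_sym p u uB by blast
        ultimately show False
          using matching pB uB by blast
      qed
      then have "c x (p u) = k"
        using no_rainbow[of x u "p u"] x uB pB \<open>p u \<noteq> x\<close> k(1) by (auto simp: B_def)
      ultimately show ?thesis
        using pB by (auto simp: M_def)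
    qed
    have B: "u \<in> B" if "u \<in> M k x" for u
      using that by (auto simp: M_def)
    obtain u where u: "u \<in> M k x"
      using k(2) by fastforce
    have pu: "p u \<in> M k x" "p u \<noteq> u" "u \<in> M m (p u)"
      using p_in[OF u] p[OF u] M_sym[OF B[OF u]] by (auto simp: M_def)
    have "card (M k x - {u, p u}) = 1"
      using k(2) u pu by (simp add: card_Diff_subset)
    then obtain w where w: "M k x - {u, p u} = {w}"
      by (auto simp: card_1_singleton_iff)
    then have wM: "w \<in> M k x" "w \<noteq> u" "w \<noteq> p u"
      by auto
    have pw: "p w \<in> M k x" "p w \<noteq> w" "w \<in> M m (p w)"
      using p_in[OF wM(1)] p[OF wM(1)] M_sym[OF B[OF wM(1)]] by (auto simp: M_def)
    then have "p w = u \<or> p w = p u"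
      using w by blast
    then show False
      using matching[of u w "p u"] matching[of "p u" w u] pw pu p[OF u] wM B u by metis
  qed
  obtain u v where "u \<in> M i x" "M m u = {}" "v \<in> M j x" "M m v = {}"
    using odd three K by metis
  moreover then have "u \<in> B" "v \<in> B" "u \<noteq> v"
    using ij by (auto simp: M_def)
  ultimately show False
    using unmatched_unique by blast
qed

text \<open>One side of a cut of nine vertices has at most four; it is excluded by
  \<open>no_small_part\<close>, or by \<open>no_dominating_vertex\<close> if it is a single
  vertex.\<close>

lemma no_mono_cut:
  assumes "A \<subseteq> V" "A \<noteq> {}" "A \<noteq> V"
    and mono: "\<And>x y. \<lbrakk>x \<in> A; y \<in> V - A\<rbrakk> \<Longrightarrow> c x y = m"
  shows False
proof -
  have small: False
    if "S \<subseteq> V" "S \<noteq> {}" "card S \<le> 4" and m: "\<And>x y. \<lbrakk>x \<in> S; y \<in> V - S\<rbrakk> \<Longrightarrow> c x y = m" for S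
  proof (cases "2 \<le> card S")
    case True
    show False
      by (rule no_small_part[OF that(1) True that(3) m])
  next
    case False
    have "card S \<noteq> 0"
      using that finite_subset[OF that(1) finite_V] by simp
    then have "card S = 1"
      using False by simp
    then obtain a where "S = {a}"
      by (auto simp: card_1_singleton_iff)
    then show False
      using no_dominating_vertex[of a m] that(1) m by simp
  qed
  have "card A + card (V - A) = 9"
    using assms(1) card_V by (metis card_Diff_subset card_mono finite_V finite_subset
        le_add_diff_inverse)
  then consider "card A \<le> 4" | "card (V - A) \<le> 4"
    by linarith
  then show False
  proof cases
    case 1
    then show False
      by (rule small[OF assms(1,2) _ mono])
  next
    case 2
    have "c x y = m" if "x \<in> V - A" "y \<in> V - (V - A)" for x y
      using mono[of y x] that sym by (metis Diff_Diff_Int IntD2)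
    then show False
      using small[of "V - A"] 2 assms(1,3) by blast
  qed
qed

lemma contradiction: False
proof -
  obtain k x y where k: "k \<in> K" and xy: "x \<in> V" "y \<in> V" "\<not> linked k x y"
    using gallai_disconnected_color[OF finite_V gallai_axioms, of K] card_V card_K by auto
  define C where "C x = {z. linked k x z}" for x
  have C_V: "C z \<subseteq> V" if "z \<in> V" for z
    using that linked_in_V by (auto simp: C_def)
  have finC: "finite (C z)" if "z \<in> V" for z
    using C_V[OF that] finite_V finite_subset by blast
  have self: "z \<in> C z" for z
    by (simp add: C_def)
  have C_disj: "C u \<inter> C v = {}" if "\<not> linked k u v" for u v
    using that linked_sym linked_trans unfolding C_def by blast
  have col_k: "c u v \<noteq> k" if "u \<in> V" "v \<in> V" "\<not> linked k u v" for u v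
    using that linked_edge by fastforce
  \<comment> \<open>Besides \<open>u\<close> and \<open>v\<close>, the two components contain the at
    least three vertices of \<open>color_nbhd V c k u v\<close>.\<close>
  have five: "5 \<le> card (C u \<union> C v)" if uv: "u \<in> V" "v \<in> V" "\<not> linked k u v" for u v
  proof -
    have "u \<noteq> v"
      using uv by auto
    have sub: "color_nbhd V c k u v \<subseteq> C u \<union> C v - {u, v}"
      using uv linked_edge by (auto simp: color_nbhd_def C_def)
    have "3 \<le> card (color_nbhd V c k u v)"
      using nbhd[of u v k] uv k \<open>u \<noteq> v\<close> col_k by blast
    also have "\<dots> \<le> card (C u \<union> C v - {u, v})"
      using sub finC uv by (intro card_mono) auto
    also have "\<dots> = card (C u \<union> C v) - 2"
      using \<open>u \<noteq> v\<close> self finC uv by (subst card_Diff_subset) auto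
    finally show ?thesis
      by linarith
  qed
  have cut: False if "u \<in> V" "v \<in> V" "\<not> linked k u v"
    and mono: "\<And>w. w \<in> V - C u \<Longrightarrow> c u w = c u v" for u v
  proof (rule no_mono_cut[of "C u" "c u v"])
    show "C u \<subseteq> V"
      using C_V that(1) .
    show "C u \<noteq> {}"
      using self by blast
    show "C u \<noteq> V"
      using that(2,3) by (auto simp: C_def)
    fix u' w assume "u' \<in> C u" "w \<in> V - C u"
    then show "c u' w = c u v"
      using color_const_left[of k u u' w] that(1) mono[of w] by (simp add: C_def)
  qed
  show False
  proof (cases "\<forall>z\<in>V. linked k x z \<or> linked k y z")
    case True
    have "c x w = c x y" if "w \<in> V - C x" for w
      using color_const[of k x x y w] xy that True by (auto simp: C_def)
    then show False
      by (rule cut[OF xy])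
  next
    case False
    then obtain z where z: "z \<in> V" "\<not> linked k x z" "\<not> linked k y z"
      by blast
    have all: "w \<in> C x \<or> w \<in> C y \<or> w \<in> C z" if w: "w \<in> V" for w
    proof (rule ccontr)
      assume "\<not> ?thesis"
      then have n: "\<not> linked k x w" "\<not> linked k y w" "\<not> linked k z w"
        by (auto simp: C_def)
      \<comment> \<open>Four components form two disjoint pairs with at least five vertices each,
        more than nine in total.\<close>
      have "(C x \<union> C y) \<inter> (C z \<union> C w) = {}"
        using C_disj n z by blast
      then have "card (C x \<union> C y) + card (C z \<union> C w) = card ((C x \<union> C y) \<union> (C z \<union> C w))"
        using finC xy z w by (simp add: card_Un_disjoint)
      also have "\<dots> \<le> card V"
        using C_V xy z w by (intro card_mono) auto
      finally show False
        using five[of x y] five[of z w] xy z w n card_V by simp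
    qed
    \<comment> \<open>If one of the three components saw the other two in the same color, it would
      be a side of a monochromatic cut. So the representatives \<open>x\<close>, \<open>y\<close>,
      \<open>z\<close> span a rainbow triangle.\<close>
    have distinct_colors: "c p q \<noteq> c p r"
      if pqr: "{p, q, r} = {x, y, z}" "\<not> linked k p q" "\<not> linked k p r" for p q r
    proof
      assume eq: "c p q = c p r"
      have V: "p \<in> V" "q \<in> V" "r \<in> V"
        using pqr(1) xy z by auto
      have "c p w = c p q" if w: "w \<in> V - C p" for w
      proof -
        have "w \<in> (\<Union>v\<in>{x, y, z}. C v)"
          using all w by auto
        then have "w \<in> C q \<or> w \<in> C r"
          using w unfolding pqr(1)[symmetric] by auto
        then show ?thesis
          using color_const[of k p p q w] color_const[of k p p r w] V pqr(2,3) eq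
          by (auto simp: C_def)
      qed
      then show False
        by (rule cut[OF V(1,2) pqr(2)])
    qed
    have n: "\<not> linked k y x" "\<not> linked k z x" "\<not> linked k z y"
      using xy z linked_sym by blast+
    have "c x y \<noteq> c x z" "c y x \<noteq> c y z" "c z x \<noteq> c z y"
      using distinct_colors[of x y z] distinct_colors[of y x z] distinct_colors[of z x y] xy z n
      by blast+
    then show False
      using no_rainbow[of x y z] xy z sym linked_refl by metis
  qed
qed

end

section \<open>Two-colored books\<close>

lemma simple_graph_book: "simple_graph (book n)"
  by (auto simp: simple_graph_def book_def graph_join_def complete_graph_def edgeless_graph_def
      card_image card_insert_if)

lemma verts_book: "verts (book n) = {Inl 0, Inl 1} \<union> Inr ` {..<n}"
  by (auto simp: book_def graph_join_def complete_graph_def edgeless_graph_def)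

lemma edges_book:
  "edges (book n) = insert {Inl 0, Inl 1} (\<Union>i<n. {{Inl 0, Inr i}, {Inl 1, Inr i}})"
proof -
  have two: "{..<2} = {0, 1 :: nat}"
    by auto
  have "{e. e \<subseteq> {0, 1} \<and> card e = 2} = {{0, 1 :: nat}}"
    by (auto simp: card_2_iff)
  then show ?thesis
    unfolding book_def graph_join_def complete_graph_def edgeless_graph_def two
    by auto
qed

lemma graph_iso_image:
  assumes "simple_graph G" "inj_on \<phi> (verts G)"
  shows "graph_iso G (\<phi> ` verts G, (\<lambda>e. \<phi> ` e) ` edges G)"
  unfolding graph_iso_def
proof (intro exI[of _ \<phi>] conjI ballI)
  fix u v assume uv: "u \<in> verts G" "v \<in> verts G"
  have "{u, v} = e" if "e \<in> edges G" "\<phi> ` {u, v} = \<phi> ` e" for e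
  proof -
    have "e \<subseteq> verts G"
      using that assms(1) by (auto simp: simple_graph_def)
    then show ?thesis
      using inj_on_image_eq_iff[OF assms(2), of "{u, v}" e] uv that(2) by auto
  qed
  then show "{u, v} \<in> edges G \<longleftrightarrow>
      {\<phi> u, \<phi> v} \<in> edges (\<phi> ` verts G, (\<lambda>e. \<phi> ` e) ` edges G)"
    by (auto simp: image_iff)
qed (use assms in \<open>auto simp: bij_betw_def\<close>)

text \<open>The possible pages over the spine \<open>x y\<close> in a book avoiding color
  \<open>k\<close>. With three colors, using at most two means avoiding one.\<close>

definition pages :: "nat \<Rightarrow> (nat set \<Rightarrow> nat) \<Rightarrow> nat \<Rightarrow> nat \<Rightarrow> nat \<Rightarrow> nat set" where
  "pages p f k x y = {w. w < p \<and> w \<noteq> x \<and> w \<noteq> y \<and> f {x, w} \<noteq> k \<and> f {y, w} \<noteq> k}"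

lemma two_colored_bookI:
  assumes col: "edge_coloring 3 (complete_graph p) f"
    and xy: "x < p" "y < p" "x \<noteq> y" and k: "k \<in> {1..3}" "f {x, y} \<noteq> k"
    and pages: "n \<le> card (pages p f k x y)"
  shows "contains_with_colors 2 (book n) p f"
proof -
  obtain P where P: "P \<subseteq> pages p f k x y" "card P = n" "finite P"
    using obtain_subset_with_card_n[OF pages] by blast
  obtain h where h: "bij_betw h {0..<n} P"
    using ex_bij_betw_nat_finite[OF P(3)] P(2) by blast
  have hP: "h i \<in> pages p f k x y" if "i < n" for i
    using h P(1) that by (auto simp: bij_betw_def)
  define \<phi> :: "nat + nat \<Rightarrow> nat" where "\<phi> = case_sum (\<lambda>i. if i = 0 then x else y) h"
  \<comment> \<open>Both forms of one are listed since simplification turns \<open>1\<close> into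
    \<open>Suc 0\<close>.\<close>
  have \<phi>: "\<phi> (Inl 0) = x" "\<phi> (Inl 1) = y" "\<phi> (Inl (Suc 0)) = y" "\<phi> (Inr i) = h i" for i
    by (simp_all add: \<phi>_def)
  have "inj_on h {..<n}"
    using h by (auto simp: bij_betw_def lessThan_atLeast0)
  moreover have "x \<notin> h ` {..<n}" "y \<notin> h ` {..<n}"
    using hP by (auto simp: pages_def)
  ultimately have inj: "inj_on \<phi> (verts (book n))"
    using xy(3) by (auto simp: verts_book \<phi> inj_on_def image_iff)
  define H where "H = (\<phi> ` verts (book n), (\<lambda>e. \<phi> ` e) ` edges (book n))"
  have edges_H: "edges H = insert {x, y} (\<Union>i<n. {{x, h i}, {y, h i}})"
    by (simp add: H_def edges_book image_UN \<phi>)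
  have verts_H: "verts H = {x, y} \<union> h ` {..<n}"
    by (simp add: H_def verts_book image_Un image_image \<phi>)
  have "card {x, h i} = 2" "card {y, h i} = 2" if "i < n" for i
    using hP[OF that] by (auto simp: pages_def card_insert_if)
  then have sub: "subgraph H (complete_graph p)"
    using xy hP
    by (auto simp: subgraph_def simple_graph_def edges_H verts_H complete_graph_def pages_def)
  have "f ` edges H \<subseteq> {1..3} - {k}"
  proof
    fix a assume "a \<in> f ` edges H"
    then obtain e where e: "e \<in> edges H" "a = f e" by blast
    have "e \<in> edges (complete_graph p)"
      using sub e(1) by (auto simp: subgraph_def)
    then have "a \<in> {1..3}"
      using col e(2) by (auto simp: edge_coloring_def)
    moreover have "a \<noteq> k"
      using e k(2) hP by (auto simp: edges_H pages_def)
    ultimately show "a \<in> {1..3} - {k}" by blast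
  qed
  then have "card (f ` edges H) \<le> card ({1..3} - {k})"
    by (intro card_mono) auto
  also have "\<dots> = 2"
    using k(1) by simp
  finally show ?thesis
    using sub graph_iso_image[OF simple_graph_book inj]
    unfolding contains_with_colors_def H_def by blast
qed

lemma two_colored_bookE:
  assumes "contains_with_colors 2 (book n) p f"
  obtains x y k where "x < p" "y < p" "x \<noteq> y" "k \<in> {1..3}" "f {x, y} \<noteq> k"
    "n \<le> card (pages p f k x y)"
proof -
  obtain H where sub: "subgraph H (complete_graph p)" and iso: "graph_iso (book n) H"
    and two: "card (f ` edges H) \<le> 2"
    using assms by (auto simp: contains_with_colors_def)
  obtain \<phi> where bij: "bij_betw \<phi> (verts (book n)) (verts H)"
    and edge: "\<And>u v. \<lbrakk>u \<in> verts (book n); v \<in> verts (book n); {u, v} \<in> edges (book n)\<rbrakk>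
      \<Longrightarrow> {\<phi> u, \<phi> v} \<in> edges H"
    using iso unfolding graph_iso_def by blast
  have VH: "verts H \<subseteq> {..<p}"
    using sub by (auto simp: subgraph_def complete_graph_def)
  \<comment> \<open>Finiteness rules out that \<open>card\<close> of the image is small merely
    because it is 0 on infinite sets.\<close>
  have "edges H \<subseteq> Pow {..<p}"
    using sub by (auto simp: subgraph_def complete_graph_def)
  then have "finite (f ` edges H)"
    using finite_subset by blast
  have "\<not> {1..3} \<subseteq> f ` edges H"
  proof
    assume "{1..3} \<subseteq> f ` edges H"
    then have "card {1..3::nat} \<le> card (f ` edges H)"
      using \<open>finite (f ` edges H)\<close> card_mono by blast
    then show False using two by simp
  qed
  then obtain k where k: "k \<in> {1..3}" "k \<notin> f ` edges H"
    by blast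
  have inj: "inj_on \<phi> (verts (book n))" and im: "\<phi> ` verts (book n) = verts H"
    using bij by (auto simp: bij_betw_def)
  let ?x = "\<phi> (Inl 0)" and ?y = "\<phi> (Inl 1)"
  have lt: "?x < p" "?y < p" "\<And>i. i < n \<Longrightarrow> \<phi> (Inr i) < p"
    using im VH by (auto simp: verts_book)
  have ne: "?x \<noteq> ?y" "\<And>i. i < n \<Longrightarrow> \<phi> (Inr i) \<noteq> ?x" "\<And>i. i < n \<Longrightarrow> \<phi> (Inr i) \<noteq> ?y"
    using inj by (auto simp: verts_book inj_on_def)
  have eH: "{?x, ?y} \<in> edges H" "\<And>i. i < n \<Longrightarrow> {?x, \<phi> (Inr i)} \<in> edges H"
    "\<And>i. i < n \<Longrightarrow> {?y, \<phi> (Inr i)} \<in> edges H"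
    by (rule edge; auto simp: verts_book edges_book)+
  have "(\<lambda>i. \<phi> (Inr i)) ` {..<n} \<subseteq> pages p f k ?x ?y"
    using lt ne k(2) eH by (auto simp: pages_def image_iff)
  moreover have "finite (pages p f k ?x ?y)"
    by (simp add: pages_def)
  ultimately have "card ((\<lambda>i. \<phi> (Inr i)) ` {..<n}) \<le> card (pages p f k ?x ?y)"
    by (rule card_mono[rotated])
  moreover have "inj_on (\<lambda>i. \<phi> (Inr i)) {..<n}"
    using inj by (auto simp: verts_book inj_on_def)
  ultimately have "n \<le> card (pages p f k ?x ?y)"
    by (simp add: card_image)
  then show thesis
    using that[of ?x ?y k] lt ne k eH(1) by blast
qed

section \<open>The two bounds\<close>

lemma upper_bound:
  assumes "gallai_coloring 3 9 f"
  shows "contains_with_colors 2 (book 5) 9 f"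
proof (rule ccontr)
  assume free: "\<not> ?thesis"
  have col: "edge_coloring 3 (complete_graph 9) f"
    using assms by (simp add: gallai_coloring_def)
  let ?c = "\<lambda>x y. f {x, y}"
  interpret book_free "{..<9}" ?c "{1..3}"
  proof unfold_locales
    fix x y z :: nat
    assume "x \<in> {..<9}" "y \<in> {..<9}" "z \<in> {..<9}" "x \<noteq> y" "x \<noteq> z" "y \<noteq> z"
    then show "?c x y = ?c x z \<or> ?c x y = ?c y z \<or> ?c x z = ?c y z"
      using assms unfolding gallai_coloring_def rainbow_triangle_def complete_graph_def by auto
  next
    fix x y :: nat
    assume "x \<in> {..<9}" "y \<in> {..<9}" "x \<noteq> y"
    then show "?c x y \<in> {1..3}"
      using col by (simp add: edge_coloring_def complete_graph_def)
  next
    fix x y k :: nat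
    assume xy: "x \<in> {..<9}" "y \<in> {..<9}" "x \<noteq> y" and k: "k \<in> {1..3}" "?c x y \<noteq> k"
    have "card (pages 9 f k x y) < 5"
      using two_colored_bookI[OF col, of x y k 5] xy k free by fastforce
    moreover have "color_nbhd {..<9} ?c k x y = {..<9} - {x, y} - pages 9 f k x y"
      by (auto simp: color_nbhd_def pages_def)
    moreover have "card ({..<9} - {x, y} - pages 9 f k x y) = 7 - card (pages 9 f k x y)"
    proof (subst card_Diff_subset)
      show "finite (pages 9 f k x y)" by (simp add: pages_def)
      show "pages 9 f k x y \<subseteq> {..<9} - {x, y}" by (auto simp: pages_def)
    qed (use xy in \<open>simp add: card_Diff_subset\<close>)
    \<comment> \<open>Fewer than five pages among seven vertices leave at least three.\<close>
    ultimately show "3 \<le> card (color_nbhd {..<9} ?c k x y)"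
      by simp
  qed (auto simp: insert_commute)
  show False
    by (rule contradiction)
qed

text \<open>The classes of \<open>div 2\<close> on the numbers below 8 are the four doubled
  vertices. Color 1 is the path 0-1-2-3 on the classes, and color 2 is its complement, the path
  2-0-3-1.\<close>

definition blowup :: "nat \<Rightarrow> nat \<Rightarrow> nat" where
  "blowup x y =
     (let i = x div 2; j = y div 2
      in if i = j then 3 else if i = Suc j \<or> j = Suc i then 1 else 2)"

text \<open>\<open>Min\<close> and \<open>Max\<close> recover the two ends of an edge; their order
  is harmless because \<open>blowup\<close> is symmetric.\<close>

definition blowup_coloring :: "nat set \<Rightarrow> nat" where
  "blowup_coloring e = blowup (Min e) (Max e)"

lemma blowup_coloring_edge: "blowup_coloring {x, y} = blowup x y"
  by (auto simp: blowup_coloring_def blowup_def Let_def min_def max_def)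

text \<open>Two vertices of one class see a vertex of another class in the same color, and three
  distinct classes span only colors 1 and 2. Ranging over lists makes the claim executable.\<close>

lemma blowup_gallai:
  "\<forall>x\<in>set [0..<8]. \<forall>y\<in>set [0..<8]. \<forall>z\<in>set [0..<8].
     x \<noteq> y \<longrightarrow> x \<noteq> z \<longrightarrow> y \<noteq> z \<longrightarrow>
     blowup x y = blowup x z \<or> blowup x y = blowup y z \<or> blowup x z = blowup y z"
  by code_simp

text \<open>Avoiding color 3 leaves the four vertices in the two classes off the spine. Avoiding
  color 1 or 2 leaves at most two classes for a spine inside a class, and only the two twins of the
  spine ends otherwise, since paths have no triangles.\<close>

lemma blowup_pages:
  "\<forall>x\<in>set [0..<8]. \<forall>y\<in>set [0..<8]. \<forall>k\<in>set [1..<4].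
     x \<noteq> y \<longrightarrow> blowup x y \<noteq> k \<longrightarrow>
     length (filter (\<lambda>w. w \<noteq> x \<and> w \<noteq> y \<and> blowup x w \<noteq> k \<and> blowup y w \<noteq> k) [0..<8]) < 5"
  by code_simp

text \<open>The coloring of eight vertices is restricted to the first \<open>p\<close>; this covers
  every value below 9, as minimality requires.\<close>

lemma lower_bound:
  assumes "p \<le> 8"
  shows "gallai_coloring 3 p blowup_coloring"
    and "\<not> contains_with_colors 2 (book 5) p blowup_coloring"
proof -
  have "\<not> rainbow_triangle p blowup_coloring x y z" for x y z
  proof
    assume "rainbow_triangle p blowup_coloring x y z"
    then have xyz: "x < 8" "y < 8" "z < 8" "x \<noteq> y" "x \<noteq> z" "y \<noteq> z"
        and "blowup x y \<noteq> blowup x z" "blowup x y \<noteq> blowup y z" "blowup x z \<noteq> blowup y z"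
      using assms by (auto simp: rainbow_triangle_def complete_graph_def blowup_coloring_edge)
    then show False
      using blowup_gallai[rule_format, of x y z] by simp
  qed
  then show "gallai_coloring 3 p blowup_coloring"
    by (auto simp: gallai_coloring_def edge_coloring_def blowup_coloring_def blowup_def Let_def)
  show "\<not> contains_with_colors 2 (book 5) p blowup_coloring"
  proof
    assume "contains_with_colors 2 (book 5) p blowup_coloring"
    then obtain x y k where xyk: "x < p" "y < p" "x \<noteq> y" "k \<in> {1..3}"
        "blowup_coloring {x, y} \<noteq> k" "5 \<le> card (pages p blowup_coloring k x y)"
      by (rule two_colored_bookE)
    let ?L = "filter (\<lambda>w. w \<noteq> x \<and> w \<noteq> y \<and> blowup x w \<noteq> k \<and> blowup y w \<noteq> k) [0..<8]"
    have "pages p blowup_coloring k x y \<subseteq> set ?L"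
      using assms by (auto simp: pages_def blowup_coloring_edge)
    then have "card (pages p blowup_coloring k x y) \<le> length ?L"
      by (meson List.finite_set card_length card_mono order_trans)
    moreover have "length ?L < 5"
      using blowup_pages xyk assms by (auto simp: blowup_coloring_edge)
    ultimately show False
      using xyk(6) by simp
  qed
qed

theorem theorem4p1: "weak_gallai_ramsey 3 2 (book 5) = 9"
  unfolding weak_gallai_ramsey_def
proof (rule Least_equality)
  show "\<forall>f. gallai_coloring 3 9 f \<longrightarrow> contains_with_colors 2 (book 5) 9 f"
    using upper_bound by blast
next
  fix p
  assume "\<forall>f. gallai_coloring 3 p f \<longrightarrow> contains_with_colors 2 (book 5) p f"
  then have "\<not> p \<le> 8"
    using lower_bound by blast
  then show "9 \<le> p" by simp
qed

end
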